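(* Let $n,k,l$ be positive integers with $l\le k\le n-1$. For a positive integer $m$ write $H_m=\sum_{i=1}^{m-1}\frac1i$, so that $H_n-H_k=\sum_{i=1}^{n-k}\frac{1}{n-i}$. Let $V_{n,d}(k,l)$ be the expected reward, with reward function $v_{n,d}$, of the stopping rule $\mathcal{R}_n(k,l)$. Then $$V_{n,1}(k,l)=\begin{cases} k\cdot(H_n-H_k) & \text{if } l=1,\\[4pt] \dfrac{n}{l-1}\cdot\left(\dfrac{k}{n}-\dfrac{\binom{n-l}{k-l}}{\binom{n}{k}}\right) & \text{if } l\ge 2,\end{cases}$$ and $$V_{n,2}(k,l)=\begin{cases} \dfrac{2n-1}{n}\cdot k\cdot(H_n-H_k)-\dfrac{k}{n}\cdot(n-k-1) & \text{if } l=1,\\[4pt] \dfrac{2n-1}{l-1}\cdot\left(\dfrac{k}{n}-\dfrac{\binom{n-l}{k-l}}{\binom{n}{k}}\right) & \text{if } l\ge 2.\end{cases}$$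
   Context: The stopping rule $\mathcal{R}_n(k,l)$ (for positive integers $l\le k\le n-1$) selects an element $s$ of a permutation $a_1,a_2,\dots,a_n$ of $\{1,2,\dots,n\}$ as follows. Let $t$ be the $l$-th lowest value among $a_1,\dots,a_k$, and let $I=\{i\in\{1,\dots,n-k\} : a_{k+i}<t\}$. Let $j=\min I$ if $I\ne\emptyset$ and $j=n-k$ if $I=\emptyset$. The rule selects $s=a_{k+j}$. For $1\le d\le n$, the reward for selecting $s$ is $v_{n,d}(s)=n+1-s$ if $s\le d$ and $v_{n,d}(s)=0$ otherwise. $V_{n,d}(k,l)$ denotes the expected value of $v_{n,d}(s)$ when the permutation is uniformly random among all $n!$ permutations. *)

theory Defs
  imports "HOL-Probability.Probability" "HOL-Combinatorics.Permutations"
begin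

(* A permutation a_1, ..., a_n of {1..n} is a function a with "a permutes {1..n}";
   the value at position i is a i. *)

(* The l-th lowest value among a_1, ..., a_k, meaningful for 1 \<le> l \<le> k; list indices start at 0. *)
definition threshold :: "(nat \<Rightarrow> nat) \<Rightarrow> nat \<Rightarrow> nat \<Rightarrow> nat" where
  "threshold a k l = sorted_list_of_set (a ` {1..k}) ! (l - 1)"

definition candidates :: "nat \<Rightarrow> (nat \<Rightarrow> nat) \<Rightarrow> nat \<Rightarrow> nat \<Rightarrow> nat set" where
  "candidates n a k l = {i \<in> {1..n - k}. a (k + i) < threshold a k l}"

definition selected :: "nat \<Rightarrow> nat \<Rightarrow> nat \<Rightarrow> (nat \<Rightarrow> nat) \<Rightarrow> nat" where
  "selected n k l a =
     (let I = candidates n a k l;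
          j = (if I \<noteq> {} then Min I else n - k)
      in a (k + j))"

definition reward :: "nat \<Rightarrow> nat \<Rightarrow> nat \<Rightarrow> real" where
  "reward n d s = (if s \<le> d then real n + 1 - real s else 0)"

definition expected_reward :: "nat \<Rightarrow> nat \<Rightarrow> nat \<Rightarrow> nat \<Rightarrow> real" where
  "expected_reward n d k l =
     measure_pmf.expectation (pmf_of_set {a. a permutes {1..n}})
       (\<lambda>a. reward n d (selected n k l a))"

(* The sum stops at m - 1, so H is the usual harmonic number shifted by one. *)
definition H :: "nat \<Rightarrow> real" where
  "H m = (\<Sum>i = 1..m - 1. 1 / real i)"

lemma H_diff:
  assumes "1 \<le> k" "k \<le> n"
  shows "H n - H k = (\<Sum>i = 1..n - k. 1 / real (n - i))"
proof -
  have "{1..n - 1} = {1..k - 1} \<union> {k..n - 1}" "{1..k - 1} \<inter> {k..n - 1} = {}"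
    using assms by auto
  then have "H n = H k + (\<Sum>i = k..n - 1. 1 / real i)"
    unfolding H_def by (simp add: sum.union_disjoint)
  moreover have "(\<Sum>i = k..n - 1. 1 / real i) = (\<Sum>i = 1..n - k. 1 / real (n - i))"
    by (rule sum.reindex_bij_witness[where i = "\<lambda>i. n - i" and j = "\<lambda>i. n - i"])
       (use assms in auto)
  ultimately show ?thesis by simp
qed

end

theory Submission
  imports Defs
begin

text \<open>The rule passes over the positions \<open>k + 1, \<dots>, m\<close> iff the \<open>l\<close> lowest values among the
  first \<open>m\<close> occupy positions in \<open>{1..k}\<close>. Permuting the first \<open>m\<close> positions shows that this has
  probability \<open>(k choose l) / (m choose l)\<close>, also conditionally on where the values 1 and 2 sit
  beyond position \<open>m\<close>. A value \<open>v \<le> l\<close> beyond position \<open>k\<close> is always below the threshold, so it is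
  selected with probability \<open>1/n\<close> times the sum of these ratios over \<open>k \<le> m < n\<close>, which telescopes
  for \<open>l \<ge> 2\<close>. For \<open>l = 1\<close> the value 2 is selected either as a genuine candidate, with 1 behind it, or
  as the last element when 1 is among the first \<open>k\<close>.\<close>

section \<open>Ranks and the positions of the lowest values\<close>

text \<open>The argument \<open>x\<close> is a value, not a position in \<open>M\<close>, so that a
  later value can be ranked among the first \<open>k\<close> positions.\<close>

definition rank_in :: "'a set \<Rightarrow> ('a \<Rightarrow> 'b::linorder) \<Rightarrow> 'b \<Rightarrow> nat" where
  "rank_in M a x = card {j \<in> M. a j \<le> x}"

text \<open>A set of positions rather than of values: rearranging \<open>M\<close> moves the
  positions but leaves the set of values on \<open>M\<close> unchanged.\<close>

definition lowest :: "'a set \<Rightarrow> ('a \<Rightarrow> 'b::linorder) \<Rightarrow> nat \<Rightarrow> 'a set" where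
  "lowest M a l = {i \<in> M. rank_in M a (a i) \<le> l}"

lemma rank_in_less:
  assumes "finite M" "j \<in> M" "x < a j"
  shows "rank_in M a x < rank_in M a (a j)"
proof -
  have "{i \<in> M. a i \<le> x} \<subseteq> {i \<in> M. a i \<le> a j}" using assms(3) by auto
  moreover have "j \<in> {i \<in> M. a i \<le> a j} - {i \<in> M. a i \<le> x}" using assms by auto
  ultimately show ?thesis
    unfolding rank_in_def using assms(1) by (intro psubset_card_mono) auto
qed

text \<open>Larger values have larger ranks, so ranks are injective; an injection of
  \<open>M\<close> into a set of size \<open>card M\<close> is onto.\<close>

lemma bij_betw_rank_in:
  assumes "finite M" "inj_on a M"
  shows "bij_betw (\<lambda>i. rank_in M a (a i)) M {1..card M}"
proof -
  have inj: "inj_on (\<lambda>i. rank_in M a (a i)) M"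
  proof (rule inj_onI)
    fix i j assume ij: "i \<in> M" "j \<in> M" and eq: "rank_in M a (a i) = rank_in M a (a j)"
    have "\<not> a i < a j" "\<not> a j < a i"
      using rank_in_less[of M j "a i" a] rank_in_less[of M i "a j" a] assms(1) ij eq by auto
    then show "i = j" using assms(2) ij by (auto dest: inj_onD)
  qed
  have sub: "(\<lambda>i. rank_in M a (a i)) ` M \<subseteq> {1..card M}"
  proof
    fix r assume "r \<in> (\<lambda>i. rank_in M a (a i)) ` M"
    then obtain i where i: "i \<in> M" "r = card {j \<in> M. a j \<le> a i}" by (auto simp: rank_in_def)
    then have "r \<noteq> 0" using assms(1) by auto
    moreover have "r \<le> card M" unfolding i(2) using assms(1) by (intro card_mono) auto
    ultimately show "r \<in> {1..card M}" by simp
  qed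
  have "(\<lambda>i. rank_in M a (a i)) ` M = {1..card M}"
    using sub inj by (intro card_subset_eq) (auto simp: card_image)
  then show ?thesis using inj by (simp add: bij_betw_def)
qed

lemma card_lowest:
  assumes "finite M" "inj_on a M" "l \<le> card M"
  shows "card (lowest M a l) = l"
proof -
  let ?r = "\<lambda>i. rank_in M a (a i)"
  have bij: "bij_betw ?r M {1..card M}" using assms by (intro bij_betw_rank_in)
  have "?r ` lowest M a l = {1..l}"
  proof
    show "?r ` lowest M a l \<subseteq> {1..l}" using bij by (auto simp: bij_betw_def lowest_def)
    show "{1..l} \<subseteq> ?r ` lowest M a l"
    proof
      fix s assume s: "s \<in> {1..l}"
      then have "s \<in> ?r ` M" using bij assms(3) by (simp add: bij_betw_def)
      then show "s \<in> ?r ` lowest M a l" using s by (auto simp: lowest_def)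
    qed
  qed
  moreover have "inj_on ?r (lowest M a l)"
    using bij by (auto simp: bij_betw_def lowest_def intro: inj_on_subset)
  ultimately show ?thesis by (metis card_image card_atLeastAtMost diff_Suc_1)
qed

text \<open>Rearranging \<open>M\<close> changes no count of small values, so \<open>a\<close> and
  \<open>a \<circ> \<sigma>\<close> have the same rank function on values; only the positions
  move.\<close>

lemma lowest_comp:
  assumes "finite M" "\<sigma> permutes M"
  shows "lowest M a l = \<sigma> ` lowest M (a \<circ> \<sigma>) l"
proof -
  have r: "rank_in M (a \<circ> \<sigma>) x = rank_in M a x" for x
  proof -
    have "{j \<in> M. a j \<le> x} = \<sigma> ` {j \<in> M. a (\<sigma> j) \<le> x}"
      using permutes_image[OF assms(2)] by auto
    moreover have "inj_on \<sigma> {j \<in> M. a (\<sigma> j) \<le> x}"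
      using permutes_inj[OF assms(2)] by (rule inj_on_subset) auto
    ultimately show ?thesis unfolding rank_in_def by (simp add: card_image)
  qed
  show ?thesis
    using permutes_image[OF assms(2)] by (auto simp: lowest_def r)
qed

text \<open>The complements in \<open>M\<close> have equal size too, so a bijection from
  \<open>S\<close> to \<open>T\<close> is glued to one between the complements and to the identity
  outside \<open>M\<close>.\<close>

lemma ex_permutes_image:
  assumes "finite M" "S \<subseteq> M" "T \<subseteq> M" "card S = card T"
  obtains \<sigma> where "\<sigma> permutes M" "\<sigma> ` S = T"
proof -
  have fin: "finite S" "finite T" using assms finite_subset by blast+
  obtain f where f: "bij_betw f S T"
    using bij_betw_iff_card[OF fin] assms(4) by auto
  have "card (M - S) = card (M - T)"
    using assms fin by (simp add: card_Diff_subset)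
  then obtain g where g: "bij_betw g (M - S) (M - T)"
    using bij_betw_iff_card[of "M - S" "M - T"] assms(1) by auto
  define \<sigma> where "\<sigma> x = (if x \<in> S then f x else if x \<in> M then g x else x)" for x
  have 1: "bij_betw \<sigma> S T" using f bij_betw_cong[of S \<sigma> f T] by (simp add: \<sigma>_def)
  have 2: "bij_betw \<sigma> (M - S) (M - T)"
    using g bij_betw_cong[of "M - S" \<sigma> g "M - T"] by (simp add: \<sigma>_def)
  have "bij_betw \<sigma> (S \<union> (M - S)) (T \<union> (M - T))" using 1 2 by (rule bij_betw_combine) auto
  then have "bij_betw \<sigma> M M" using assms(2,3) by (simp add: Un_absorb1)
  then have "\<sigma> permutes M" using assms(2) by (intro bij_imp_permutes) (auto simp: \<sigma>_def)
  moreover have "\<sigma> ` S = T" using 1 by (simp add: bij_betw_def)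
  ultimately show thesis by (rule that)
qed

text \<open>The set of positions of the \<open>l\<close> lowest values is equidistributed over the \<open>l\<close>-subsets of \<open>M\<close>.\<close>

lemma card_lowest_subset:
  assumes "finite M" "K \<subseteq> M" "l \<le> card M" "finite A"
    and inj: "\<And>a. a \<in> A \<Longrightarrow> inj_on a M"
    and closed: "\<And>a \<sigma>. a \<in> A \<Longrightarrow> \<sigma> permutes M \<Longrightarrow> a \<circ> \<sigma> \<in> A"
  shows "card {a \<in> A. lowest M a l \<subseteq> K} * (card M choose l) = (card K choose l) * card A"
proof -
  define F where "F S = {a \<in> A. lowest M a l = S}" for S
  have finF: "finite (F S)" for S using assms(4) by (simp add: F_def)
  \<comment> \<open>Precomposition with a permutation taking \<open>S\<close> to \<open>T\<close>
    embeds the fibre over \<open>T\<close> into the fibre over \<open>S\<close>. Exchanging the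
    roles of \<open>S\<close> and \<open>T\<close> then gives equality.\<close>
  have le: "card (F T) \<le> card (F S)" if "S \<subseteq> M" "T \<subseteq> M" "card S = l" "card T = l" for S T
  proof -
    obtain \<sigma> where \<sigma>: "\<sigma> permutes M" "\<sigma> ` S = T"
      using assms(1) \<open>S \<subseteq> M\<close> \<open>T \<subseteq> M\<close> \<open>card S = l\<close> \<open>card T = l\<close> by (metis ex_permutes_image)
    show ?thesis
    proof (rule card_inj_on_le[where f = "\<lambda>a. a \<circ> \<sigma>"])
      show "inj_on (\<lambda>a. a \<circ> \<sigma>) (F T)"
        using permutes_surj[OF \<sigma>(1)] by (intro inj_onI) (auto simp: fun_eq_iff surj_def, metis)
      show "(\<lambda>a. a \<circ> \<sigma>) ` F T \<subseteq> F S"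
      proof
        fix b assume "b \<in> (\<lambda>a. a \<circ> \<sigma>) ` F T"
        then obtain a where a: "a \<in> A" "lowest M a l = T" "b = a \<circ> \<sigma>" by (auto simp: F_def)
        have "\<sigma> ` lowest M b l = \<sigma> ` S"
          using lowest_comp[OF assms(1) \<sigma>(1)] a \<sigma>(2) by metis
        then have "lowest M b l = S" using permutes_inj[OF \<sigma>(1)] by (simp add: inj_image_eq_iff)
        then show "b \<in> F S" using a closed \<sigma>(1) by (simp add: F_def)
      qed
    qed (rule finF)
  qed
  obtain S0 where S0: "S0 \<subseteq> M" "card S0 = l"
    using assms(1,3) obtain_subset_with_card_n by metis
  have count: "card {a \<in> A. lowest M a l \<subseteq> N} = (card N choose l) * card (F S0)" if "N \<subseteq> M" for N
  proof -
    have finN: "finite N" using that assms(1) finite_subset by blast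
    have "{a \<in> A. lowest M a l \<subseteq> N} = (\<Union>S\<in>{S. S \<subseteq> N \<and> card S = l}. F S)"
      using card_lowest[OF assms(1) inj assms(3)] by (auto simp: F_def)
    also have "card \<dots> = (\<Sum>S\<in>{S. S \<subseteq> N \<and> card S = l}. card (F S))"
      using finN finF by (intro card_UN_disjoint) (auto simp: F_def)
    also have "\<dots> = (\<Sum>S\<in>{S. S \<subseteq> N \<and> card S = l}. card (F S0))"
      using le S0 that by (intro sum.cong refl antisym) auto
    also have "\<dots> = (card N choose l) * card (F S0)"
      using finN by (simp add: n_subsets)
    finally show ?thesis .
  qed
  \<comment> \<open>For \<open>N = M\<close> the condition is vacuous, so \<open>count\<close> gives
    \<open>card A\<close>. The common fibre size cancels against the case
    \<open>N = K\<close>.\<close>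
  have "{a \<in> A. lowest M a l \<subseteq> M} = A" by (auto simp: lowest_def)
  then show ?thesis using count[OF assms(2)] count[of M] by simp
qed

section \<open>Counting permutations with one or two prescribed values\<close>

text \<open>Precomposing with the transposition of \<open>p\<close> and \<open>x\<close> moves the
  value \<open>x\<close> from position \<open>p\<close> to position \<open>x\<close>, making it a
  fixed point that can be removed from \<open>S\<close>.\<close>

lemma permutes_comp_transpose_iff:
  assumes "p \<in> S" "x \<in> S"
  shows "a \<circ> Transposition.transpose p x permutes S - {x} \<longleftrightarrow> a permutes S \<and> a p = x"
proof
  assume b: "a \<circ> Transposition.transpose p x permutes S - {x}"
  then have "(a \<circ> Transposition.transpose p x) \<circ> Transposition.transpose p x permutes S"
    by (intro permutes_compose[OF permutes_swap_id] assms permutes_subset[OF b]) auto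
  moreover have "(a \<circ> Transposition.transpose p x) x = x" using b by (rule permutes_not_in) simp
  ultimately show "a permutes S \<and> a p = x" by (simp add: comp_assoc)
next
  assume a: "a permutes S \<and> a p = x"
  then have "a \<circ> Transposition.transpose p x permutes S"
    by (intro permutes_compose[OF permutes_swap_id] assms) auto
  then show "a \<circ> Transposition.transpose p x permutes S - {x}"
    by (rule permutes_superset) (use a in auto)
qed

lemma card_comp_transpose:
  "card {a. P (a \<circ> Transposition.transpose p x)} = card {b. P b}"
proof (rule bij_betw_same_card)
  show "bij_betw (\<lambda>a. a \<circ> Transposition.transpose p x) {a. P (a \<circ> Transposition.transpose p x)} {b. P b}"
    by (rule bij_betwI[where g = "\<lambda>b. b \<circ> Transposition.transpose p x"]) (auto simp: comp_assoc)
qed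

lemma card_permutes_fixed_value:
  assumes "finite S" "p \<in> S" "x \<in> S"
  shows "card {a. a permutes S \<and> a p = x} = fact (card S - 1)"
proof -
  have "card {a. a permutes S \<and> a p = x} = card {b. b permutes (S - {x})}"
    using card_comp_transpose[of "\<lambda>b. b permutes S - {x}" p x]
    by (simp only: permutes_comp_transpose_iff[OF assms(2,3)])
  also have "\<dots> = fact (card S - 1)"
    using assms by (intro card_permutations) auto
  finally show ?thesis .
qed

lemma card_permutes_two_fixed_values:
  assumes "finite S" "p \<in> S" "x \<in> S" "q \<in> S" "y \<in> S" "p \<noteq> q" "x \<noteq> y"
  shows "card {a. a permutes S \<and> a p = x \<and> a q = y} = fact (card S - 2)"
proof -
  let ?t = "Transposition.transpose p x"
  have "{a. a permutes S \<and> a p = x \<and> a q = y} =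
      {a. a \<circ> ?t permutes S - {x} \<and> (a \<circ> ?t) (?t q) = y}"
    by (simp add: permutes_comp_transpose_iff[OF assms(2,3)])
  then have "card {a. a permutes S \<and> a p = x \<and> a q = y} =
      card {b. b permutes (S - {x}) \<and> b (?t q) = y}"
    using card_comp_transpose[of "\<lambda>b. b permutes S - {x} \<and> b (?t q) = y"] by (simp only:)
  also have "\<dots> = fact (card (S - {x}) - 1)"
    \<comment> \<open>As \<open>q\<close> differs from \<open>p\<close>, the position
      \<open>?t q\<close> differs from \<open>x\<close> and stays in \<open>S - {x}\<close>.\<close>
    using assms by (intro card_permutes_fixed_value) (auto simp: Transposition.transpose_def)
  also have "card (S - {x}) - 1 = card S - 2" using assms by simp
  finally show ?thesis .
qed

section \<open>The threshold and the stopping position in terms of ranks\<close>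

text \<open>In the sorted list, an element at most \<open>x\<close> has index below
  \<open>l - 1\<close> if \<open>x\<close> is below entry \<open>l - 1\<close>; otherwise the first
  \<open>l\<close> entries are all at most \<open>x\<close>. This trades list indexing for
  counting.\<close>

lemma less_nth_sorted_list_of_set_iff:
  fixes X :: "'a::linorder set"
  assumes "finite X" "1 \<le> l" "l \<le> card X"
  shows "x < sorted_list_of_set X ! (l - 1) \<longleftrightarrow> card {y \<in> X. y \<le> x} < l"
proof -
  define xs where "xs = sorted_list_of_set X"
  have xs: "set xs = X" "sorted xs" "distinct xs" "length xs = card X"
    using assms(1) by (auto simp: xs_def)
  have inj: "inj_on ((!) xs) I" if "I \<subseteq> {..<length xs}" for I
    using inj_on_nth[OF xs(3), of I] that by auto
  have "card {y \<in> X. y \<le> x} < l" if "x < xs ! (l - 1)"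
  proof -
    have "{y \<in> X. y \<le> x} \<subseteq> (!) xs ` {..<l - 1}"
    proof
      fix y assume y: "y \<in> {y \<in> X. y \<le> x}"
      then obtain i where i: "i < length xs" "y = xs ! i"
        using xs(1) by (auto simp: in_set_conv_nth)
      have "\<not> l - 1 \<le> i"
      proof
        assume "l - 1 \<le> i"
        then have "xs ! (l - 1) \<le> xs ! i" using i xs(2) by (intro sorted_nth_mono)
        then show False using that y i by auto
      qed
      then show "y \<in> (!) xs ` {..<l - 1}" using i by auto
    qed
    then have "card {y \<in> X. y \<le> x} \<le> card {..<l - 1}"
      by (rule surj_card_le[rotated]) simp
    then show ?thesis using assms(2) by simp
  qed
  moreover have "l \<le> card {y \<in> X. y \<le> x}" if "xs ! (l - 1) \<le> x"
  proof -
    have "(!) xs ` {..<l} \<subseteq> {y \<in> X. y \<le> x}"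
    proof
      fix y assume "y \<in> (!) xs ` {..<l}"
      then obtain i where i: "i < l" "y = xs ! i" by auto
      have "xs ! i \<le> xs ! (l - 1)" using i assms xs by (intro sorted_nth_mono) auto
      moreover have "xs ! i \<in> X" using i assms(3) xs by (metis nth_mem order_less_le_trans)
      ultimately show "y \<in> {y \<in> X. y \<le> x}" using that i by auto
    qed
    moreover have "card ((!) xs ` {..<l}) = l"
      using inj[of "{..<l}"] assms(3) xs(4) by (simp add: card_image)
    moreover have "finite {y \<in> X. y \<le> x}" using assms(1) by simp
    ultimately show ?thesis by (metis card_mono)
  qed
  ultimately show ?thesis unfolding xs_def by (meson not_le)
qed

lemma less_threshold_iff:
  assumes "inj_on a {1..k}" "1 \<le> l" "l \<le> k"
  shows "x < threshold a k l \<longleftrightarrow> rank_in {1..k} a x < l"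
proof -
  have "card {y \<in> a ` {1..k}. y \<le> x} = card (a ` {j \<in> {1..k}. a j \<le> x})"
    by (rule arg_cong[where f = card]) auto
  also have "\<dots> = rank_in {1..k} a x"
    unfolding rank_in_def by (intro card_image inj_on_subset[OF assms(1)]) auto
  finally show ?thesis
    unfolding threshold_def using assms
    by (subst less_nth_sorted_list_of_set_iff) (auto simp: card_image)
qed

text \<open>If the \<open>l\<close> lowest positions lie in \<open>K\<close>, a position
  \<open>p\<close> outside \<open>K\<close> has rank above \<open>l\<close> in \<open>M\<close>, so
  those \<open>l\<close> positions all carry values at most \<open>a p\<close>. Conversely, a low
  \<open>p\<close> outside \<open>K\<close> counts itself in \<open>M\<close> but not in
  \<open>K\<close>, so its rank in \<open>K\<close> is below \<open>l\<close>.\<close>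

lemma lowest_subset_iff:
  fixes a :: "'a \<Rightarrow> 'b::linorder"
  assumes "finite M" "inj_on a M" "K \<subseteq> M" "l \<le> card M"
  shows "lowest M a l \<subseteq> K \<longleftrightarrow> (\<forall>p\<in>M - K. l \<le> rank_in K a (a p))"
proof
  have finK: "finite K" using assms finite_subset by blast
  show "\<forall>p\<in>M - K. l \<le> rank_in K a (a p)" if sub: "lowest M a l \<subseteq> K"
  proof
    fix p assume p: "p \<in> M - K"
    have "rank_in M a (a p) > l" using p sub by (auto simp: lowest_def)
    then have "a i \<le> a p" if "i \<in> lowest M a l" for i
      using that p rank_in_less[OF assms(1), of i "a p" a]
      by (fastforce simp: lowest_def)
    then have "lowest M a l \<subseteq> {j \<in> K. a j \<le> a p}" using sub by auto
    then have "card (lowest M a l) \<le> rank_in K a (a p)"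
      unfolding rank_in_def using finK by (intro card_mono) auto
    then show "l \<le> rank_in K a (a p)" using card_lowest assms by metis
  qed
  show "lowest M a l \<subseteq> K" if r: "\<forall>p\<in>M - K. l \<le> rank_in K a (a p)"
  proof (rule subsetI, rule ccontr)
    fix p assume p: "p \<in> lowest M a l" "p \<notin> K"
    then have "p \<in> M" by (simp add: lowest_def)
    have "rank_in K a (a p) < rank_in M a (a p)"
      unfolding rank_in_def using assms p \<open>p \<in> M\<close> by (intro psubset_card_mono) auto
    moreover have "l \<le> rank_in K a (a p)" using r p(2) \<open>p \<in> M\<close> by blast
    ultimately show False using p(1) by (simp add: lowest_def)
  qed
qed

text \<open>Here \<open>m\<close> is the last position passed over, so the selection happens at
  \<open>Suc m\<close>. The \<open>lowest\<close> condition says that no candidate occurs up to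
  \<open>m\<close>; the disjunct \<open>Suc m = n\<close> is the default choice of the last
  element.\<close>

lemma selected_eq_iff:
  assumes "inj_on a {1..n}" "1 \<le> l" "l \<le> k" "k < n"
  shows "selected n k l a = v \<longleftrightarrow>
    (\<exists>m\<in>{k..<n}. a (Suc m) = v \<and> lowest {1..m} a l \<subseteq> {1..k} \<and>
       (rank_in {1..k} a v < l \<or> Suc m = n))"
proof -
  define C where "C = candidates n a k l"
  define j where "j = (if C \<noteq> {} then Min C else n - k)"
  have sel: "selected n k l a = a (k + j)" by (simp add: selected_def C_def j_def)
  have finC: "finite C" by (simp add: C_def candidates_def)
  have inj: "inj_on a {1..m}" if "m \<le> n" for m
    using assms(1) by (rule inj_on_subset) (use that in auto)
  have C: "i \<in> C \<longleftrightarrow> i \<in> {1..n - k} \<and> rank_in {1..k} a (a (k + i)) < l" for i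
    unfolding C_def candidates_def using less_threshold_iff[OF inj] assms by simp
  have low: "lowest {1..m} a l \<subseteq> {1..k} \<longleftrightarrow> (\<forall>i\<in>C. m < k + i)" if "m \<in> {k..<n}" for m
  proof -
    have "lowest {1..m} a l \<subseteq> {1..k} \<longleftrightarrow> (\<forall>p\<in>{1..m} - {1..k}. l \<le> rank_in {1..k} a (a p))"
      using that assms by (intro lowest_subset_iff inj) auto
    also have "\<dots> \<longleftrightarrow> (\<forall>i\<in>C. m < k + i)"
    proof
      assume L: "\<forall>p\<in>{1..m} - {1..k}. l \<le> rank_in {1..k} a (a p)"
      show "\<forall>i\<in>C. m < k + i"
      proof (rule ballI, rule ccontr)
        fix i assume "i \<in> C" "\<not> m < k + i"
        then show False using L[rule_format, of "k + i"] C[of i] by auto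
      qed
    next
      assume R: "\<forall>i\<in>C. m < k + i"
      show "\<forall>p\<in>{1..m} - {1..k}. l \<le> rank_in {1..k} a (a p)"
      proof (rule ballI, rule ccontr)
        fix p assume p: "p \<in> {1..m} - {1..k}" "\<not> l \<le> rank_in {1..k} a (a p)"
        then have "p - k \<in> C" using C[of "p - k"] that by auto
        then show False using R p by fastforce
      qed
    qed
    finally show ?thesis .
  qed
  have j: "j \<in> {1..n - k}"
  proof (cases "C = {}")
    case False
    then have "j \<in> C" using finC by (simp add: j_def)
    then show ?thesis using C by blast
  qed (use assms in \<open>simp add: j_def\<close>)
  \<comment> \<open>Without candidates the first conjunct is vacuous and \<open>Suc m = n\<close> is
    the default; otherwise \<open>j\<close> is the first candidate.\<close>
  have stop: "Suc m = k + j \<longleftrightarrow> (\<forall>i\<in>C. m < k + i) \<and> (Suc m - k \<in> C \<or> Suc m = n)"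
    if m: "m \<in> {k..<n}" for m
  proof (cases "C = {}")
    case True
    then show ?thesis using assms by (auto simp: j_def)
  next
    case False
    then have jC: "j \<in> C" and jmin: "\<And>i. i \<in> C \<Longrightarrow> j \<le> i" using finC by (auto simp: j_def)
    show ?thesis
    proof
      assume "Suc m = k + j"
      then show "(\<forall>i\<in>C. m < k + i) \<and> (Suc m - k \<in> C \<or> Suc m = n)"
        using jC jmin by fastforce
    next
      assume R: "(\<forall>i\<in>C. m < k + i) \<and> (Suc m - k \<in> C \<or> Suc m = n)"
      then have "m < k + j" using jC by blast
      \<comment> \<open>Minimality of \<open>j\<close> if \<open>Suc m - k\<close> is a candidate,
        and the bound \<open>n - k\<close> on \<open>j\<close> if \<open>Suc m = n\<close>.\<close>
      moreover have "k + j \<le> Suc m"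
        using R jmin[of "Suc m - k"] m j by auto
      ultimately show "Suc m = k + j" by simp
    qed
  qed
  have "selected n k l a = v \<longleftrightarrow> (\<exists>m\<in>{k..<n}. Suc m = k + j \<and> a (Suc m) = v)"
  proof
    assume "selected n k l a = v"
    then show "\<exists>m\<in>{k..<n}. Suc m = k + j \<and> a (Suc m) = v"
      using j assms by (intro bexI[of _ "k + j - 1"]) (auto simp: sel)
  qed (auto simp: sel)
  also have "\<dots> \<longleftrightarrow> (\<exists>m\<in>{k..<n}. a (Suc m) = v \<and> lowest {1..m} a l \<subseteq> {1..k} \<and>
       (rank_in {1..k} a v < l \<or> Suc m = n))"
  proof (rule bex_cong[OF refl])
    fix m assume m: "m \<in> {k..<n}"
    then have "Suc m - k \<in> C \<longleftrightarrow> rank_in {1..k} a (a (Suc m)) < l"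
      using C[of "Suc m - k"] by auto
    then show "Suc m = k + j \<and> a (Suc m) = v \<longleftrightarrow> a (Suc m) = v \<and> lowest {1..m} a l \<subseteq> {1..k} \<and>
       (rank_in {1..k} a v < l \<or> Suc m = n)"
      using stop[OF m] low[OF m] by auto
  qed
  finally show ?thesis .
qed

section \<open>Counting permutations that pass over a prefix, given values beyond it\<close>

lemma card_permutes_value_in_image:
  assumes "finite S" "p \<in> S" "x \<in> S" "y \<in> S" "x \<noteq> y" "Q \<subseteq> S - {p}"
  shows "card {a. a permutes S \<and> a p = x \<and> y \<in> a ` Q} = card Q * fact (card S - 2)"
proof -
  have fin: "finite Q" "finite {a. a permutes S \<and> a p = x \<and> a q = y}" for q
    using assms finite_subset[OF _ finite_permutations[OF assms(1)]] by (auto intro: finite_subset)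
  have "{a. a permutes S \<and> a p = x \<and> y \<in> a ` Q} =
      (\<Union>q\<in>Q. {a. a permutes S \<and> a p = x \<and> a q = y})" by auto
  also have "card \<dots> = (\<Sum>q\<in>Q. card {a. a permutes S \<and> a p = x \<and> a q = y})"
    by (intro card_UN_disjoint ballI impI fin) (auto dest: permutes_inj injD)
  also have "\<dots> = (\<Sum>q\<in>Q. fact (card S - 2))"
    using assms by (intro sum.cong refl card_permutes_two_fixed_values) auto
  finally show ?thesis by simp
qed

lemma permutes_comp_prefix:
  fixes n m :: nat
  assumes "a permutes {1..n}" "\<sigma> permutes {1..m}" "m \<le> n"
  shows "a \<circ> \<sigma> permutes {1..n}" "\<And>j. m < j \<Longrightarrow> (a \<circ> \<sigma>) j = a j"
proof -
  have "\<sigma> permutes {1..n}" using assms by (intro permutes_subset[OF assms(2)]) auto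
  then show "a \<circ> \<sigma> permutes {1..n}" by (rule permutes_compose) (rule assms(1))
  show "(a \<circ> \<sigma>) j = a j" if "m < j" for j
    using permutes_not_in[OF assms(2), of j] that by simp
qed

text \<open>Any event \<open>Q\<close> invariant under rearranging the first \<open>m\<close>
  positions is independent of where the low values sit among them, so equidistribution applies
  within \<open>Q\<close>.\<close>

lemma card_permutes_lowest_subset:
  fixes n m k l :: nat
  assumes "l \<le> k" "k \<le> m" "m \<le> n" "Q \<subseteq> {a. a permutes {1..n}}"
    and "\<And>a \<sigma>. a \<in> Q \<Longrightarrow> \<sigma> permutes {1..m} \<Longrightarrow> a \<circ> \<sigma> \<in> Q"
  shows "real (card {a \<in> Q. lowest {1..m} a l \<subseteq> {1..k}}) =
    real (card Q) * real (k choose l) / real (m choose l)"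
proof -
  have "card {a \<in> Q. lowest {1..m} a l \<subseteq> {1..k}} * (card {1..m} choose l) =
      (card {1..k} choose l) * card Q"
  proof (rule card_lowest_subset)
    show "finite Q" using assms(4) by (rule finite_subset) (simp add: finite_permutations)
    show "inj_on a {1..m}" if "a \<in> Q" for a
      using that assms(4) by (auto intro: permutes_inj_on)
  qed (use assms in auto)
  then have "card {a \<in> Q. lowest {1..m} a l \<subseteq> {1..k}} * (m choose l) = (k choose l) * card Q"
    by simp
  then have "real (card {a \<in> Q. lowest {1..m} a l \<subseteq> {1..k}}) * real (m choose l) =
      real (k choose l) * real (card Q)"
    by (simp only: of_nat_mult[symmetric])
  moreover have "real (m choose l) > 0" using assms by simp
  ultimately show ?thesis by (simp add: field_simps)
qed

lemma card_permutes_value_lowest_subset: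
  fixes n m k l v :: nat
  assumes "l \<le> k" "k \<le> m" "m < n" "v \<in> {1..n}"
  shows "real (card {a. a permutes {1..n} \<and> a (Suc m) = v \<and> lowest {1..m} a l \<subseteq> {1..k}}) =
    fact (n - 1) * real (k choose l) / real (m choose l)"
proof -
  let ?Q = "{a. a permutes {1..n} \<and> a (Suc m) = v}"
  have "real (card {a \<in> ?Q. lowest {1..m} a l \<subseteq> {1..k}}) =
      real (card ?Q) * real (k choose l) / real (m choose l)"
  proof (rule card_permutes_lowest_subset[where n = n])
    fix a \<sigma> assume "a \<in> ?Q" "\<sigma> permutes {1..m}"
    then show "a \<circ> \<sigma> \<in> ?Q"
      using permutes_comp_prefix[of a n \<sigma> m] assms by simp
  qed (use assms in auto)
  also have "card ?Q = fact (n - 1)"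
    using card_permutes_fixed_value[of "{1..n}" "Suc m" v] assms by simp
  finally show ?thesis by (simp add: conj_ac)
qed

text \<open>Both prescribed values lie beyond position \<open>m\<close>, so the event is invariant
  under rearranging the prefix. The factor \<open>n - Suc m\<close> counts the places left for the
  value 1.\<close>

lemma card_permutes_two_values_lowest_subset:
  fixes n m k :: nat
  assumes "1 \<le> k" "k \<le> m" "m < n" "n \<ge> 2"
  shows "real (card {a. a permutes {1..n} \<and> a (Suc m) = 2 \<and> 1 \<in> a ` {Suc (Suc m)..n} \<and>
      lowest {1..m} a 1 \<subseteq> {1..k}}) =
    real (n - Suc m) * fact (n - 2) * real k / real m"
proof -
  let ?Q = "{a. a permutes {1..n} \<and> a (Suc m) = 2 \<and> 1 \<in> a ` {Suc (Suc m)..n}}"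
  have "real (card {a \<in> ?Q. lowest {1..m} a 1 \<subseteq> {1..k}}) =
      real (card ?Q) * real (k choose 1) / real (m choose 1)"
  proof (rule card_permutes_lowest_subset[where n = n])
    fix a \<sigma> assume a: "a \<in> ?Q" and \<sigma>: "\<sigma> permutes {1..m}"
    have c: "a \<circ> \<sigma> permutes {1..n}" "\<And>j. m < j \<Longrightarrow> (a \<circ> \<sigma>) j = a j"
      using permutes_comp_prefix[OF _ \<sigma>] a assms by auto
    have "(a \<circ> \<sigma>) ` {Suc (Suc m)..n} = a ` {Suc (Suc m)..n}"
      by (intro image_cong refl c(2)) auto
    then show "a \<circ> \<sigma> \<in> ?Q" using a c(1) c(2)[of "Suc m"] by simp
  qed (use assms in auto)
  also have "card ?Q = (n - Suc m) * fact (n - 2)"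
    using card_permutes_value_in_image[of "{1..n}" "Suc m" 2 1 "{Suc (Suc m)..n}"] assms
    by (auto simp: subset_iff)
  finally show ?thesis by (simp add: conj_ac)
qed

lemma card_UN_value_at:
  fixes n v :: nat
  shows "card (\<Union>m\<in>{k..<n}. {a. a permutes {1..n} \<and> a (Suc m) = v \<and> P m a}) =
    (\<Sum>m\<in>{k..<n}. card {a. a permutes {1..n} \<and> a (Suc m) = v \<and> P m a})"
proof (intro card_UN_disjoint ballI impI)
  show "finite {a. a permutes {1..n} \<and> a (Suc m) = v \<and> P m a}" for m
    by (rule finite_subset[OF _ finite_permutations[of "{1..n}"]]) auto
qed (auto dest: permutes_inj injD)

section \<open>Counting the permutations for which a given value is selected\<close>

text \<open>A value \<open>v \<le> l\<close> beyond position \<open>k\<close> is always a candidate,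
  so it is selected iff everything before it is passed over. The count does not depend on
  \<open>v\<close>; it serves \<open>v = 1\<close>, and \<open>v = 2\<close> when
  \<open>l \<ge> 2\<close>.\<close>

lemma card_selected_eq:
  assumes "1 \<le> v" "v \<le> l" "l \<le> k" "k < n"
  shows "real (card {a. a permutes {1..n} \<and> selected n k l a = v}) =
    fact (n - 1) * (\<Sum>m\<in>{k..<n}. real (k choose l) / real (m choose l))"
proof -
  have rank: "rank_in {1..k} a v < l"
    if a: "a permutes {1..n}" "a (Suc m) = v" and m: "m \<in> {k..<n}" for a m
  proof -
    \<comment> \<open>Since \<open>v\<close> itself sits beyond position \<open>k\<close>, at most
      \<open>v - 1\<close> values among the first \<open>k\<close> are at most
      \<open>v\<close>.\<close>
    have "a ` {j \<in> {1..k}. a j \<le> v} \<subseteq> {1..<v}"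
    proof
      fix y assume "y \<in> a ` {j \<in> {1..k}. a j \<le> v}"
      then obtain j where j: "j \<in> {1..k}" "a j \<le> v" "y = a j" by auto
      have "a j \<noteq> a (Suc m)" using inj_eq[OF permutes_inj[OF a(1)]] j m by simp
      moreover have "a j \<in> {1..n}"
        using permutes_in_image[OF a(1), of j] j(1) assms(4) by auto
      ultimately show "y \<in> {1..<v}" using a(2) j by auto
    qed
    then have "card (a ` {j \<in> {1..k}. a j \<le> v}) \<le> card {1..<v}" by (intro card_mono) auto
    moreover have "card (a ` {j \<in> {1..k}. a j \<le> v}) = rank_in {1..k} a v"
      unfolding rank_in_def by (intro card_image permutes_inj_on[OF a(1)])
    ultimately show ?thesis using assms by simp
  qed
  have "{a. a permutes {1..n} \<and> selected n k l a = v} =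
      (\<Union>m\<in>{k..<n}. {a. a permutes {1..n} \<and> a (Suc m) = v \<and> lowest {1..m} a l \<subseteq> {1..k}})"
  proof (intro set_eqI)
    fix a
    show "a \<in> {a. a permutes {1..n} \<and> selected n k l a = v} \<longleftrightarrow> a \<in> (\<Union>m\<in>{k..<n}.
        {a. a permutes {1..n} \<and> a (Suc m) = v \<and> lowest {1..m} a l \<subseteq> {1..k}})"
    proof (cases "a permutes {1..n}")
      case True
      have "selected n k l a = v \<longleftrightarrow>
          (\<exists>m\<in>{k..<n}. a (Suc m) = v \<and> lowest {1..m} a l \<subseteq> {1..k})"
        using selected_eq_iff[OF permutes_inj_on[OF True], of l k n v] rank[OF True] assms by auto
      then show ?thesis using True by simp
    qed simp
  qed
  then have "card {a. a permutes {1..n} \<and> selected n k l a = v} =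
      (\<Sum>m\<in>{k..<n}. card {a. a permutes {1..n} \<and> a (Suc m) = v \<and> lowest {1..m} a l \<subseteq> {1..k}})"
    by (simp only: card_UN_value_at)
  also have "real \<dots> = (\<Sum>m\<in>{k..<n}. fact (n - 1) * real (k choose l) / real (m choose l))"
    unfolding of_nat_sum using assms
    by (intro sum.cong refl card_permutes_value_lowest_subset) auto
  finally show ?thesis by (simp add: sum_distrib_left)
qed

text \<open>If 1 is among the first \<open>k\<close> values, nothing is below the threshold and only
  the last element can be taken. Otherwise 2 is a candidate once it lies beyond \<open>k\<close>,
  and 1 must not precede it.\<close>

lemma selected_one_eq_two_iff:
  assumes a: "a permutes {1..n}" and "1 \<le> k" "k < n"
  shows "selected n k 1 a = 2 \<longleftrightarrow>
    (\<exists>m\<in>{k..<n}. a (Suc m) = 2 \<and> 1 \<in> a ` {Suc (Suc m)..n} \<and> lowest {1..m} a 1 \<subseteq> {1..k}) \<or>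
    (a n = 2 \<and> 1 \<in> a ` {1..k})"
proof -
  have inj: "a i = a j \<longleftrightarrow> i = j" for i j using permutes_inj[OF a] by (rule inj_eq)
  have pos: "a j \<ge> 1" if "j \<in> {1..n}" for j using permutes_in_image[OF a, of j] that by auto
  have "1 \<in> a ` {1..n}" using permutes_image[OF a] assms by simp
  then obtain p where p: "p \<in> {1..n}" "a p = 1" by force
  have im: "1 \<in> a ` X \<longleftrightarrow> p \<in> X" for X using p(2) inj by (metis image_iff)
  have low: "lowest {1..m} a 1 = {p}" if "p \<in> {1..m}" "m < n" for m
  proof -
    have "{j \<in> {1..m}. a j \<le> 1} = {p}"
    proof -
      have "j = p" if "j \<in> {1..m}" "a j \<le> 1" for j
      proof -
        have "a j = a p" using pos[of j] that \<open>m < n\<close> p(2) by simp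
        then show ?thesis by (simp only: inj)
      qed
      moreover have "a p \<le> 1" using p(2) by simp
      ultimately show ?thesis using that(1) by blast
    qed
    then have "p \<in> lowest {1..m} a 1" using that p(2) by (simp add: lowest_def rank_in_def)
    moreover have "card (lowest {1..m} a 1) = 1"
      using that by (intro card_lowest permutes_inj_on[OF a]) auto
    ultimately show ?thesis by (auto simp: card_1_singleton_iff)
  qed
  \<comment> \<open>Only the values 1 and 2 are at most 2, and 2 sits beyond position
    \<open>k\<close>.\<close>
  have rank: "rank_in {1..k} a 2 < 1 \<longleftrightarrow> p \<notin> {1..k}" if "a (Suc m) = 2" "k \<le> m" for m
  proof -
    have "rank_in {1..k} a 2 < 1 \<longleftrightarrow> (\<forall>j\<in>{1..k}. \<not> a j \<le> 2)" by (auto simp: rank_in_def)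
    also have "\<dots> \<longleftrightarrow> p \<notin> {1..k}"
    proof
      assume p': "p \<notin> {1..k}"
      show "\<forall>j\<in>{1..k}. \<not> a j \<le> 2"
      proof
        fix j assume j: "j \<in> {1..k}"
        then have "a j \<noteq> a p" "a j \<noteq> a (Suc m)" using p' that(2) by (auto simp: inj)
        then show "\<not> a j \<le> 2" using pos[of j] j assms(3) p(2) that(1) by auto
      qed
    next
      have "a p \<le> 2" using p(2) by simp
      then show "\<forall>j\<in>{1..k}. \<not> a j \<le> 2 \<Longrightarrow> p \<notin> {1..k}" by blast
    qed
    finally show ?thesis .
  qed
  have "lowest {1..m} a 1 \<subseteq> {1..k} \<and> (rank_in {1..k} a 2 < 1 \<or> Suc m = n) \<longleftrightarrow>
      1 \<in> a ` {Suc (Suc m)..n} \<and> lowest {1..m} a 1 \<subseteq> {1..k} \<or> Suc m = n \<and> 1 \<in> a ` {1..k}"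
    if m: "m \<in> {k..<n}" and v: "a (Suc m) = 2" for m
  proof -
    \<comment> \<open>The position \<open>p\<close> of the value 1 is at most \<open>k\<close>, or
      from \<open>k + 1\<close> to \<open>m\<close> (where both sides fail by \<open>low\<close>),
      or beyond \<open>Suc m\<close>.\<close>
    have "p \<noteq> Suc m" using p(2) v by auto
    moreover have "lowest {1..m} a 1 \<subseteq> {1..k} \<longleftrightarrow> p \<le> k \<or> lowest {1..m} a 1 \<subseteq> {1..k} \<and> m < p"
      using low[of m] p(1) m by (cases "p \<le> m") auto
    moreover have "rank_in {1..k} a 2 < 1 \<longleftrightarrow> k < p" using rank[OF v] m p(1) by auto
    moreover have "p \<in> {1..k} \<longleftrightarrow> p \<le> k" "p \<in> {Suc (Suc m)..n} \<longleftrightarrow> Suc m < p"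
      using p(1) by auto
    moreover have "k \<le> m" "m < n" using m by auto
    ultimately show ?thesis unfolding im by linarith
  qed
  then have "selected n k 1 a = 2 \<longleftrightarrow> (\<exists>m\<in>{k..<n}. a (Suc m) = 2 \<and>
      (1 \<in> a ` {Suc (Suc m)..n} \<and> lowest {1..m} a 1 \<subseteq> {1..k} \<or> Suc m = n \<and> 1 \<in> a ` {1..k}))"
    using assms selected_eq_iff[OF permutes_inj_on[OF a], of 1 k n 2] by (metis order_refl)
  also have "\<dots> \<longleftrightarrow>
    (\<exists>m\<in>{k..<n}. a (Suc m) = 2 \<and> 1 \<in> a ` {Suc (Suc m)..n} \<and> lowest {1..m} a 1 \<subseteq> {1..k}) \<or>
    (\<exists>m\<in>{k..<n}. Suc m = n \<and> a (Suc m) = 2 \<and> 1 \<in> a ` {1..k})" by blast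
  also have "(\<exists>m\<in>{k..<n}. Suc m = n \<and> a (Suc m) = 2 \<and> 1 \<in> a ` {1..k}) \<longleftrightarrow>
      a n = 2 \<and> 1 \<in> a ` {1..k}"
  proof
    assume "a n = 2 \<and> 1 \<in> a ` {1..k}"
    then show "\<exists>m\<in>{k..<n}. Suc m = n \<and> a (Suc m) = 2 \<and> 1 \<in> a ` {1..k}"
      using assms by (intro bexI[of _ "n - 1"]) simp_all
  qed blast
  finally show ?thesis .
qed

text \<open>The sum counts the cases with 1 behind 2. The summand 1 is the default case: 2 is last
  and 1 takes any of \<open>k\<close> positions.\<close>

lemma card_selected_one_eq_two:
  assumes "1 \<le> k" "k < n"
  shows "real (card {a. a permutes {1..n} \<and> selected n k 1 a = 2}) =
    fact (n - 2) * real k * ((\<Sum>m\<in>{k..<n}. real (n - Suc m) / real m) + 1)"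
proof -
  let ?A = "\<Union>m\<in>{k..<n}. {a. a permutes {1..n} \<and> a (Suc m) = 2 \<and> 1 \<in> a ` {Suc (Suc m)..n} \<and>
      lowest {1..m} a 1 \<subseteq> {1..k}}"
  let ?B = "{a. a permutes {1..n} \<and> a n = 2 \<and> 1 \<in> a ` {1..k}}"
  have fin: "finite {a. a permutes {1..n}}" by (simp add: finite_permutations)
  \<comment> \<open>The value 1 lies beyond position \<open>k\<close> in \<open>?A\<close> and among
    the first \<open>k\<close> positions in \<open>?B\<close>.\<close>
  have disj: "?A \<inter> ?B = {}"
  proof -
    have False if "a permutes {1..n}" "a i = 1" "a j = 1" "i \<le> k" "k < j" for a i j
      using permutes_inj[OF that(1)] that by (metis injD not_le)
    then show ?thesis by fastforce
  qed
  have sub: "{1..k} \<subseteq> {1..n} - {n}" using assms by auto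
  have eq: "{a. a permutes {1..n} \<and> selected n k 1 a = 2} = ?A \<union> ?B"
    using selected_one_eq_two_iff[OF _ assms] by auto
  have "card (?A \<union> ?B) = card ?A + card ?B"
    using disj by (intro card_Un_disjoint) (auto intro: finite_subset[OF _ fin])
  moreover have B: "card ?B = card {1..k} * fact (card {1..n} - 2)"
  proof (rule card_permutes_value_in_image[OF _ _ _ _ _ sub])
    show "n \<in> {1..n}" "2 \<in> {1..n}" "1 \<in> {1..n}" using assms by simp_all
  qed simp_all
  ultimately have "real (card {a. a permutes {1..n} \<and> selected n k 1 a = 2}) =
      real (card ?A) + real (card {1..k}) * fact (card {1..n} - 2)"
    unfolding eq B by (simp only: of_nat_add of_nat_mult of_nat_fact)
  also have "\<dots> = real (card ?A) + real k * fact (n - 2)" by (simp only: card_atLeastAtMost diff_Suc_1)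
  also have "real (card ?A) = (\<Sum>m\<in>{k..<n}. real (n - Suc m) * fact (n - 2) * real k / real m)"
    unfolding card_UN_value_at of_nat_sum using assms
    by (intro sum.cong refl card_permutes_two_values_lowest_subset) auto
  also have "\<dots> = fact (n - 2) * real k * (\<Sum>m\<in>{k..<n}. real (n - Suc m) / real m)"
    by (simp add: sum_distrib_left mult_ac)
  finally show ?thesis by (simp add: algebra_simps)
qed

section \<open>The expected reward and the sums that occur in it\<close>

lemma expected_reward_eq:
  assumes "1 \<le> l" "l \<le> k" "k < n"
  shows "expected_reward n d k l = (\<Sum>s = 1..d. (real n + 1 - real s) *
    real (card {a. a permutes {1..n} \<and> selected n k l a = s})) / fact n"
proof -
  let ?P = "{a. a permutes {1..n}}"
  have fin: "finite ?P" and ne: "?P \<noteq> {}" by (auto simp: finite_permutations intro: permutes_id)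
  \<comment> \<open>\<open>reward\<close> would be nonzero at 0, so 0 must be ruled out before the
    sum over selected values can start at 1.\<close>
  have pos: "selected n k l a \<ge> 1" if a: "a permutes {1..n}" for a
  proof -
    obtain m where "m \<in> {k..<n}" "a (Suc m) = selected n k l a"
      using selected_eq_iff[OF permutes_inj_on[OF a] assms] by blast
    then show ?thesis using permutes_in_image[OF a, of "Suc m"] by auto
  qed
  have "(\<Sum>a\<in>?P. reward n d (selected n k l a)) =
      (\<Sum>a\<in>?P. \<Sum>s = 1..d. if selected n k l a = s then real n + 1 - real s else 0)"
    using pos by (intro sum.cong refl) (auto simp: reward_def)
  also have "\<dots> = (\<Sum>s = 1..d. \<Sum>a\<in>?P. if selected n k l a = s then real n + 1 - real s else 0)"
    by (rule sum.swap)
  also have "\<dots> = (\<Sum>s = 1..d. (real n + 1 - real s) *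
      real (card {a. a permutes {1..n} \<and> selected n k l a = s}))"
    using fin by (intro sum.cong refl) (simp add: sum.If_cases Int_def)
  finally show ?thesis
    unfolding expected_reward_def
    by (subst integral_pmf_of_set[OF ne fin]) (simp add: card_permutations)
qed

text \<open>With g(m) = m * (k choose l) / (m choose l), absorption gives g(m) - g(m + 1) = (l - 1)
  * (k choose l) / (m choose l). The sum telescopes from g(k) = k; \<open>l \<ge> 2\<close> permits
  dividing by \<open>l - 1\<close>.\<close>

lemma sum_inverse_choose:
  assumes "2 \<le> l" "l \<le> k" "k \<le> n"
  shows "(\<Sum>m\<in>{k..<n}. real (k choose l) / real (m choose l)) =
    (real k - real n * real (k choose l) / real (n choose l)) / (real l - 1)"
  using assms(3)
proof (induction n rule: dec_induct)
  case base
  then show ?case using assms by simp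
next
  case (step n)
  have pos: "real (n choose l) > 0" "real (Suc n choose l) > 0" "real l - 1 > 0"
    using step assms by auto
  have "Suc n * (n choose l) = (Suc n choose l) * (Suc n - l)"
    using binomial_absorb_comp[of "Suc n" l] by (simp add: mult.commute)
  then have "real (Suc n) * real (n choose l) = real (Suc n choose l) * (real (Suc n) - real l)"
    using step assms by (metis of_nat_diff of_nat_mult le_SucI le_trans)
  then have "real (Suc n) / real (Suc n choose l) = (real (Suc n) - real l) / real (n choose l)"
    using pos by (simp add: field_simps)
  then have eq: "real (Suc n) * real (k choose l) / real (Suc n choose l) =
      (real n + 1 - real l) * real (k choose l) / real (n choose l)"
    by (metis (no_types, opaque_lifting) of_nat_Suc add.commute times_divide_eq_left)
  define q where "q = real (k choose l) / real (n choose l)"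
  define S where "S = (\<Sum>m\<in>{k..<n}. real (k choose l) / real (m choose l))"
  have "S = (real k - real n * q) / (real l - 1)"
    using step.IH by (simp add: S_def q_def)
  then have "S + q = (real k - (real n + 1 - real l) * q) / (real l - 1)"
    using pos(3) by (simp add: field_simps)
  then show ?case
    using eq step.hyps(1) by (simp add: S_def q_def)
qed

text \<open>The shift in \<open>H\<close> makes the difference run over exactly the prefix lengths
  \<open>m\<close> at which the rule can stop next.\<close>

lemma H_diff_eq:
  assumes "1 \<le> k" "k \<le> n"
  shows "H n - H k = (\<Sum>m\<in>{k..<n}. 1 / real m)"
proof -
  have "H m = (\<Sum>i\<in>{1..<m}. 1 / real i)" for m
    unfolding H_def by (rule sum.cong) auto
  then show ?thesis
    using sum.atLeastLessThan_concat[of 1 k n "\<lambda>i. 1 / real i"] assms by simp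
qed

theorem theorem2:
  fixes n k l :: nat
  assumes "1 \<le> l" and "l \<le> k" and "k \<le> n - 1"
  shows "expected_reward n 1 k l =
           (if l = 1 then real k * (H n - H k)
            else real n / (real l - 1) *
                 (real k / real n - real ((n - l) choose (k - l)) / real (n choose k)))
       \<and> expected_reward n 2 k l =
           (if l = 1 then (2 * real n - 1) / real n * real k * (H n - H k)
                          - real k / real n * (real n - real k - 1)
            else (2 * real n - 1) / (real l - 1) *
                 (real k / real n - real ((n - l) choose (k - l)) / real (n choose k)))"
proof -
  have kn: "k < n" "1 \<le> k" and n2: "2 \<le> n" using assms by auto
  then have n1: "real n - 1 > 0" by simp
  define T where "T = (\<Sum>m\<in>{k..<n}. real (k choose l) / real (m choose l))"
  define c2 where "c2 = real (card {a. a permutes {1..n} \<and> selected n k l a = 2})"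
  have fact1: "(fact n :: real) = real n * fact (n - 1)"
    using n2 by (simp add: fact_reduce)
  have fact2: "(fact (n - 1) :: real) = (real n - 1) * fact (n - 2)"
    using n2 fact_reduce[of "n - 1", where ?'a = real] by (simp add: numeral_2_eq_2)
  have c1: "real (card {a. a permutes {1..n} \<and> selected n k l a = 1}) = fact (n - 1) * T"
    unfolding T_def using assms kn by (intro card_selected_eq) auto
  \<comment> \<open>The value 1 is selected with probability \<open>T / n\<close> and earns
    \<open>n\<close>.\<close>
  have E1: "expected_reward n 1 k l = T"
    using expected_reward_eq[OF assms(1,2) kn(1), of 1] n2 by (simp add: c1[simplified] fact1)
  have "{1..2::nat} = {1, 2}" by auto
  then have "expected_reward n 2 k l = (real n * (fact (n - 1) * T) + (real n - 1) * c2) / fact n"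
    using expected_reward_eq[OF assms(1,2) kn(1), of 2] by (simp add: c1[simplified] c2_def)
  then have E2: "expected_reward n 2 k l = T + (real n - 1) * c2 / fact n"
    using n2 by (simp add: fact1 field_simps)
  show ?thesis
  proof (cases "l = 1")
    case True
    have T: "T = real k * (H n - H k)"
      using kn by (simp add: T_def True H_diff_eq sum_distrib_left)
    \<comment> \<open>Each term is (n - 1)/m - 1, which separates a harmonic sum from the number
      \<open>n - k\<close> of terms.\<close>
    have "(\<Sum>m\<in>{k..<n}. real (n - Suc m) / real m) =
        (\<Sum>m\<in>{k..<n}. (real n - 1) * (1 / real m) - 1)"
      using kn by (intro sum.cong refl) (auto simp: of_nat_diff field_simps)
    also have "\<dots> = (real n - 1) * (H n - H k) - (real n - real k)"
      unfolding sum_subtractf sum_distrib_left[symmetric] using kn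
      by (simp add: H_diff_eq of_nat_diff)
    finally have "c2 = fact (n - 2) * real k * ((real n - 1) * (H n - H k) - (real n - real k) + 1)"
      using card_selected_one_eq_two[OF kn(2,1)] by (simp add: c2_def True)
    moreover have cancel: "N * (f * x * y) / (r * (N * f)) = x * y / r" if "N > 0" "f > 0"
      for N f x y r :: real
      using that by simp
    ultimately have "(real n - 1) * c2 / fact n =
        real k * ((real n - 1) * (H n - H k) - (real n - real k) + 1) / real n"
      unfolding fact1 fact2 using cancel n1 by simp
    with E2 T have "expected_reward n 2 k l = real k * (H n - H k) +
        real k * ((real n - 1) * (H n - H k) - (real n - real k) + 1) / real n" by simp
    also have "\<dots> = (2 * real n - 1) / real n * real k * (H n - H k)
        - real k / real n * (real n - real k - 1)"
      using n2 by (simp add: field_simps)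
    finally show ?thesis using E1 T True by simp
  next
    case False
    have pos: "real n > 0" "real l - 1 > 0" "real (n choose l) > 0" "real (n choose k) > 0"
      using assms False n2 kn by auto
    \<comment> \<open>Choosing \<open>k\<close> of \<open>n\<close> and then \<open>l\<close> of
      those, or the \<open>l\<close> first, turns the telescoped ratio into the one of the
      theorem.\<close>
    have "real (n choose k) * real (k choose l) =
        real (n choose l) * real ((n - l) choose (k - l))"
      using choose_mult[of l k n] assms kn by (metis of_nat_mult less_imp_le)
    then have ratio: "real ((n - l) choose (k - l)) / real (n choose k) =
        real (k choose l) / real (n choose l)"
      using pos by (simp add: field_simps)
    have scale: "real n / (real l - 1) * (real k / real n - q) = (real k - real n * q) / (real l - 1)" for q
      using pos by (simp add: field_simps)
    have "T = (real k - real n * (real (k choose l) / real (n choose l))) / (real l - 1)"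
      unfolding T_def using sum_inverse_choose[of l k n] assms False kn by simp
    then have T: "T = real n / (real l - 1) *
        (real k / real n - real ((n - l) choose (k - l)) / real (n choose k))"
      by (simp only: ratio scale)
    \<comment> \<open>As \<open>l \<ge> 2\<close>, the value 2 is selected as often as 1. The
      rewards \<open>n\<close> and \<open>n - 1\<close> add up to the factor 2n - 1.\<close>
    have "c2 = fact (n - 1) * T"
      unfolding T_def c2_def using assms False kn by (intro card_selected_eq) auto
    then have "expected_reward n 2 k l = (2 * real n - 1) / real n * T"
      using E2 n2 by (simp add: fact1 add_divide_distrib diff_divide_distrib left_diff_distrib)
    then show ?thesis using E1 T False pos by simp
  qed
qed

end
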